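(* Fix admissible shared class constants defining $\mathcal{M}_{\mathrm{reg}}$, and let $\mathcal{K}=\{K_\theta:\theta\in\Theta\}$ be a candidate family with severity bound $\bar s_{\mathcal{K}}$. (a) (Sufficiency.) Suppose $\mathcal{K}$ satisfies the injectivity clause (C-b): for every $\theta\in\Theta$ the map $F\mapsto K_\theta F$ is injective on the Borel probability measures on $[0,\bar s_{\mathcal{K}}]$. Then for every admissible edge map $\ell_0$, if two members $(F_S,K),(F_S',K')$ of the fiber $\mathcal{M}_{\mathcal{K}}(\ell_0)$ satisfy $KF_S=K'F_S'$, then $F_S=F_S'$; consequently $(\alpha,L,p_\tau)=(\alpha',L',p'_\tau)$. In particular $(L,p_\tau)$ is identifiable on every fiber $\mathcal{M}_{\mathcal{K}}(\ell_0)$. (b) (Location families.) If $\mathcal{K}$ is a location family, i.e. $K_\theta(\cdot\mid s)=\mathrm{Law}(g_\theta(s)+W)$ for all $\theta\in\Theta$, $s\ge 0$, with Borel location maps $g_\theta$ and a real random variable $W$ whose law has compact support and does not depend on $s$, then $\mathcal{K}$ satisfies (C-b).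
   Context: A pair $(F_S,K)$ consists of a Borel probability law $F_S$ on $[0,\infty)$ and a Markov kernel $K$ from $[0,\infty)$ to $[0,\infty]$ such that $K([0,\infty)\mid s)>0$ for every $s\ge 0$. Observed law: $(KF_S)(B)=\int_{[0,\infty)}K(B\mid s)\,F_S(ds)$. With $\operatorname{supp}$ the topological support in $[0,\infty]$, put $\ell(s)=\ell_K(s):=\inf(\operatorname{supp}K(\cdot\mid s)\cap[0,\infty))$, $u(s):=\sup(\operatorname{supp}K(\cdot\mid s)\cap[0,\infty))$, $w(s):=u(s)-\ell(s)$, $m(s):=\tfrac12(\ell(s)+u(s))-s$. Admissible shared class constants: $\beta\ge 0$, $\bar b<\infty$, $0<c_-\le c_+<\infty$, $\bar s_0>0$, $s_R,s_A\in(0,\bar s_0]$, $0<\tau<s_R$. Axioms: A1: $F_S(\{0\})=0$ and there are $s_0\ge\bar s_0$, $L\in(0,\infty)$, $\alpha\in[0,\infty)$ such that $F_S$ has a density $f_S$ on $(0,s_0)$ (a fixed version) with $f_S(s)=Ls^{\alpha}(1+o(1))$ pointwise as $s\downarrow 0$ (then $(\alpha,L)$ is determined by $F_S$). A2: $w(s)<\infty$ for every $s\ge 0$, and $K(\{+\infty\}\mid s)=0$ for all $s\in[0,s_A]$. A3: $\sup_{s\ge 0}|m(s)|\le\bar b$ and $m\not\equiv 0$. A4: $\lim_{s\downarrow 0}w(s)/s=\infty$. NA: there is no Borel probability $\mu$ on $\mathbb{R}$ such that for $F_S$-a.e. $s$, $K(\{+\infty\}\mid s)=0$ and $K(B\mid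 s)=\mu(B-s)$ for every Borel $B\subseteq[0,\infty)$. A5: $a:=\ell(0+)\in[0,\infty)$ exists and, with the convention $\ell(0):=a$, $c_-(s'-s)\le\ell(s')-\ell(s)\le c_+(s'-s)$ for all $0\le s\le s'\le s_R$, and $\ell$ is nondecreasing on $[0,\infty)$. A6: there is $c_K:(0,s_R]\to(0,\infty)$ with $0<\liminf_{s\downarrow 0}c_K(s)\le\limsup_{s\downarrow 0}c_K(s)<\infty$ such that for every $\varepsilon>0$ there is $\eta(\varepsilon)>0$ with $(1-\varepsilon)c_K(s)\delta^{\beta+1}\le K([\ell(s),\ell(s)+\delta]\mid s)\le(1+\varepsilon)c_K(s)\delta^{\beta+1}$ for all $s\in(0,s_R]$, $\delta\in(0,\eta(\varepsilon)]$. $\mathcal{M}_{\mathrm{reg}}$: all pairs satisfying A1--A6 and NA with the given constants. The estimand is $(\alpha,L,p_\tau)$ with $(\alpha,L)$ from A1 and $p_\tau=F_S([0,\tau])$. A candidate family is a known family $\mathcal{K}=\{K_\theta:\theta\in\Theta\}$, $\Theta\subseteq\mathbb{R}^k$, of Markov kernels from $[0,\infty)$ to $[0,\infty]$, together with a severity bound $\bar s_{\mathcal{K}}<\infty$, such that each edge map $\ell_{K_\theta}$ is strictly increasing on $[0,\infty)$ and (clause (C-a)) within the family the edge determines the parameter: $\ell_{K_\theta}=\ell_{K_{\theta'}}$ implies $\theta=\theta'$. An edge map $\ell_0$ is admissible if $\ell_0=\ell_{K_\theta}$ for some $\theta\in\Theta$. The fiber is $\mathcal{M}_{\mathcal{K}}(\ell_0):=\{(F_S,K)\in\mathcal{M}_{\mathrm{reg}}: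 K\in\mathcal{K},\ \ell_K=\ell_0,\ \operatorname{supp}F_S\subseteq[0,\bar s_{\mathcal{K}}]\}$. Identifiability of a functional on a class means that members of the class with equal observed laws have equal functional values. *)

theory Defs
  imports "HOL-Probability.Probability" "HOL-Library.Landau_Symbols"
begin

abbreviation halfline :: "real measure"
  where "halfline \<equiv> restrict_space borel {0..}"

definition law_on_halfline :: "real measure \<Rightarrow> bool"
  where "law_on_halfline F \<longleftrightarrow> F \<in> space (prob_algebra halfline)"

(* The state space [0,\<infinity>] is the type ennreal. Only the values K s with s \<ge> 0 are
   meaningful; equality of kernels and of edge maps is therefore always stated on s \<ge> 0. *)

definition markov_kernel :: "(real \<Rightarrow> ennreal measure) \<Rightarrow> bool"
  where "markov_kernel K \<longleftrightarrow> K \<in> halfline \<rightarrow>\<^sub>M prob_algebra borel"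

definition obs_pair :: "real measure \<Rightarrow> (real \<Rightarrow> ennreal measure) \<Rightarrow> bool"
  where "obs_pair F K \<longleftrightarrow> law_on_halfline F \<and> markov_kernel K \<and>
    (\<forall>s\<ge>0. emeasure (K s) {x. x < \<infinity>} > 0)"

definition observed :: "(real \<Rightarrow> ennreal measure) \<Rightarrow> real measure \<Rightarrow> ennreal measure"
  where "observed K F = F \<bind> K"

definition supp :: "'a::topological_space measure \<Rightarrow> 'a set"
  where "supp M = {x \<in> space M. \<forall>U. open U \<longrightarrow> x \<in> U \<longrightarrow> emeasure M (U \<inter> space M) > 0}"

(* Inf and Sup are taken in [0,\<infinity>]: a kernel without mass on [0,\<infinity>) has lower edge \<infinity>,
   so strict monotonicity of an edge map forces all its values to be finite. *)

definition lower_edge :: "(real \<Rightarrow> ennreal measure) \<Rightarrow> real \<Rightarrow> ennreal"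
  where "lower_edge K s = Inf (supp (K s) \<inter> {x. x < \<infinity>})"

definition upper_edge :: "(real \<Rightarrow> ennreal measure) \<Rightarrow> real \<Rightarrow> ennreal"
  where "upper_edge K s = Sup (supp (K s) \<inter> {x. x < \<infinity>})"

definition width :: "(real \<Rightarrow> ennreal measure) \<Rightarrow> real \<Rightarrow> ereal"
  where "width K s = enn2ereal (upper_edge K s) - enn2ereal (lower_edge K s)"

definition midpoint_bias :: "(real \<Rightarrow> ennreal measure) \<Rightarrow> real \<Rightarrow> ereal"
  where "midpoint_bias K s =
    (enn2ereal (lower_edge K s) + enn2ereal (upper_edge K s)) / 2 - ereal s"

record class_consts =
  c_beta :: real
  c_bbar :: real
  c_minus :: real
  c_plus :: real
  c_s0bar :: real
  c_sR :: real
  c_sA :: real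
  c_tau :: real

definition admissible_consts :: "class_consts \<Rightarrow> bool"
  where "admissible_consts C \<longleftrightarrow>
    0 \<le> c_beta C \<and> 0 < c_minus C \<and> c_minus C \<le> c_plus C \<and> 0 < c_s0bar C \<and>
    0 < c_sR C \<and> c_sR C \<le> c_s0bar C \<and> 0 < c_sA C \<and> c_sA C \<le> c_s0bar C \<and>
    0 < c_tau C \<and> c_tau C < c_sR C"

definition ax_A1 :: "class_consts \<Rightarrow> real measure \<Rightarrow> real \<Rightarrow> real \<Rightarrow> bool"
  where "ax_A1 C F \<alpha> L \<longleftrightarrow> emeasure F {0} = 0 \<and> 0 \<le> \<alpha> \<and> 0 < L \<and>
    (\<exists>s0 f. c_s0bar C \<le> s0 \<and> f \<in> borel_measurable borel \<and> (\<forall>s\<in>{0<..<s0}. 0 \<le> f s) \<and>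
       (\<forall>B\<in>sets borel. B \<subseteq> {0<..<s0} \<longrightarrow>
          emeasure F B = (\<integral>\<^sup>+s\<in>B. ennreal (f s) \<partial>lborel)) \<and>
       f \<sim>[at_right 0] (\<lambda>s. L * s powr \<alpha>))"

definition ax_A2 :: "class_consts \<Rightarrow> (real \<Rightarrow> ennreal measure) \<Rightarrow> bool"
  where "ax_A2 C K \<longleftrightarrow> (\<forall>s\<ge>0. width K s < \<infinity>) \<and> (\<forall>s\<in>{0..c_sA C}. emeasure (K s) {\<infinity>} = 0)"

definition ax_A3 :: "class_consts \<Rightarrow> (real \<Rightarrow> ennreal measure) \<Rightarrow> bool"
  where "ax_A3 C K \<longleftrightarrow> (SUP s\<in>{0..}. \<bar>midpoint_bias K s\<bar>) \<le> ereal (c_bbar C) \<and>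
    (\<exists>s\<ge>0. midpoint_bias K s \<noteq> 0)"

definition ax_A4 :: "(real \<Rightarrow> ennreal measure) \<Rightarrow> bool"
  where "ax_A4 K \<longleftrightarrow> ((\<lambda>s. width K s / ereal s) \<longlongrightarrow> \<infinity>) (at_right 0)"

definition ax_NA :: "real measure \<Rightarrow> (real \<Rightarrow> ennreal measure) \<Rightarrow> bool"
  where "ax_NA F K \<longleftrightarrow> \<not> (\<exists>\<mu>\<in>space (prob_algebra (borel :: real measure)).
    AE s in F. emeasure (K s) {\<infinity>} = 0 \<and>
      (\<forall>B\<in>sets borel. B \<subseteq> {0..} \<longrightarrow>
         emeasure (K s) (ennreal ` B) = emeasure \<mu> ((\<lambda>x. x - s) ` B)))"

(* The value of the edge map at 0 is replaced by its right limit in this axiom only. *)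
definition ax_A5 :: "class_consts \<Rightarrow> (real \<Rightarrow> ennreal measure) \<Rightarrow> bool"
  where "ax_A5 C K \<longleftrightarrow> (\<exists>a::real. 0 \<le> a \<and> (lower_edge K \<longlongrightarrow> ennreal a) (at_right 0) \<and>
    (let l = (lower_edge K)(0 := ennreal a) in
       (\<forall>s s'. 0 \<le> s \<longrightarrow> s \<le> s' \<longrightarrow> s' \<le> c_sR C \<longrightarrow>
          ereal (c_minus C * (s' - s)) \<le> enn2ereal (l s') - enn2ereal (l s) \<and>
          enn2ereal (l s') - enn2ereal (l s) \<le> ereal (c_plus C * (s' - s))) \<and>
       mono_on {0..} l))"

definition ax_A6 :: "class_consts \<Rightarrow> (real \<Rightarrow> ennreal measure) \<Rightarrow> bool"
  where "ax_A6 C K \<longleftrightarrow> (\<exists>cK::real \<Rightarrow> real.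
    (\<forall>s\<in>{0<..c_sR C}. 0 < cK s) \<and>
    0 < Liminf (at_right 0) (\<lambda>s. ereal (cK s)) \<and>
    Limsup (at_right 0) (\<lambda>s. ereal (cK s)) < \<infinity> \<and>
    (\<forall>\<epsilon>>0. \<exists>\<eta>>0. \<forall>s\<in>{0<..c_sR C}. \<forall>\<delta>\<in>{0<..\<eta>}.
       (1 - \<epsilon>) * cK s * \<delta> powr (c_beta C + 1)
         \<le> measure (K s) {lower_edge K s..lower_edge K s + ennreal \<delta>} \<and>
       measure (K s) {lower_edge K s..lower_edge K s + ennreal \<delta>}
         \<le> (1 + \<epsilon>) * cK s * \<delta> powr (c_beta C + 1)))"

definition M_reg :: "class_consts \<Rightarrow> (real measure \<times> (real \<Rightarrow> ennreal measure)) set"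
  where "M_reg C = {(F, K). obs_pair F K \<and> (\<exists>\<alpha> L. ax_A1 C F \<alpha> L) \<and> ax_A2 C K \<and> ax_A3 C K \<and>
    ax_A4 K \<and> ax_NA F K \<and> ax_A5 C K \<and> ax_A6 C K}"

definition edge_params :: "class_consts \<Rightarrow> real measure \<Rightarrow> real \<times> real"
  where "edge_params C F = (THE (\<alpha>, L). ax_A1 C F \<alpha> L)"

definition edge_coeff :: "class_consts \<Rightarrow> real measure \<Rightarrow> real"
  where "edge_coeff C F = snd (edge_params C F)"

definition p_tau :: "class_consts \<Rightarrow> real measure \<Rightarrow> real"
  where "p_tau C F = measure F {0..c_tau C}"

definition candidate_family ::
    "(real^'k) set \<Rightarrow> (real^'k \<Rightarrow> real \<Rightarrow> ennreal measure) \<Rightarrow> bool"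
  where "candidate_family \<Theta> K \<longleftrightarrow>
    (\<forall>\<theta>\<in>\<Theta>. markov_kernel (K \<theta>) \<and> strict_mono_on {0..} (lower_edge (K \<theta>))) \<and>
    (\<forall>\<theta>\<in>\<Theta>. \<forall>\<theta>'\<in>\<Theta>.
       (\<forall>s\<ge>0. lower_edge (K \<theta>) s = lower_edge (K \<theta>') s) \<longrightarrow> \<theta> = \<theta>')"

definition admissible_edge ::
    "(real^'k) set \<Rightarrow> (real^'k \<Rightarrow> real \<Rightarrow> ennreal measure) \<Rightarrow> (real \<Rightarrow> ennreal) \<Rightarrow> bool"
  where "admissible_edge \<Theta> K l0 \<longleftrightarrow> (\<exists>\<theta>\<in>\<Theta>. \<forall>s\<ge>0. l0 s = lower_edge (K \<theta>) s)"

definition fiber ::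
    "class_consts \<Rightarrow> (real^'k) set \<Rightarrow> (real^'k \<Rightarrow> real \<Rightarrow> ennreal measure) \<Rightarrow> real \<Rightarrow>
     (real \<Rightarrow> ennreal) \<Rightarrow> (real measure \<times> (real \<Rightarrow> ennreal measure)) set"
  where "fiber C \<Theta> K sbar l0 = {(F, K1) \<in> M_reg C.
    (\<exists>\<theta>\<in>\<Theta>. \<forall>s\<ge>0. K1 s = K \<theta> s) \<and> (\<forall>s\<ge>0. lower_edge K1 s = l0 s) \<and>
    supp F \<subseteq> {0..sbar}}"

(* Borel laws on [0, sbar] are the laws on [0,\<infinity>) that give [0, sbar] full mass. *)
definition injectivity_clause ::
    "(real^'k) set \<Rightarrow> (real^'k \<Rightarrow> real \<Rightarrow> ennreal measure) \<Rightarrow> real \<Rightarrow> bool"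
  where "injectivity_clause \<Theta> K sbar \<longleftrightarrow>
    (\<forall>\<theta>\<in>\<Theta>. inj_on (observed (K \<theta>)) {F. law_on_halfline F \<and> emeasure F {0..sbar} = 1})"

(* \<mu> is the law of W. Since ennreal truncates negative reals to 0, the condition that
   g \<theta> s + W takes values in [0,\<infinity>) has to be stated separately. *)
definition location_family ::
    "(real^'k) set \<Rightarrow> (real^'k \<Rightarrow> real \<Rightarrow> ennreal measure) \<Rightarrow> bool"
  where "location_family \<Theta> K \<longleftrightarrow>
    (\<exists>(g :: real^'k \<Rightarrow> real \<Rightarrow> real) (\<mu> :: real measure).
       \<mu> \<in> space (prob_algebra borel) \<and> compact (supp \<mu>) \<and>
       (\<forall>\<theta>\<in>\<Theta>. g \<theta> \<in> borel_measurable halfline \<and>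
          (\<forall>s\<ge>0. (AE w in \<mu>. 0 \<le> g \<theta> s + w) \<and>
                 K \<theta> s = distr \<mu> borel (\<lambda>w. ennreal (g \<theta> s + w)))))"

definition identifiable ::
    "(real measure \<times> (real \<Rightarrow> ennreal measure) \<Rightarrow> 'b) \<Rightarrow>
     (real measure \<times> (real \<Rightarrow> ennreal measure)) set \<Rightarrow> bool"
  where "identifiable T M \<longleftrightarrow> (\<forall>(F, K)\<in>M. \<forall>(F', K')\<in>M.
    observed K F = observed K' F' \<longrightarrow> T (F, K) = T (F', K'))"

end

theory Submission
  imports Defs
begin

text \<open>For a location family, strict monotonicity of the lower edge forces the location map \<open>g\<close> to be
  strictly increasing, so \<open>g(S)\<close> is bounded and its law determines that of \<open>S\<close>. The observed law
  is that of \<open>g(S) + W\<close> with \<open>S\<close> and \<open>W\<close> independent; by the binomial formula its moments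
  determine those of \<open>g(S)\<close> recursively, and a bounded law is determined by its moments. Working
  with moments avoids the zeros of the characteristic function of \<open>W\<close>.\<close>

section \<open>Topological support and laws on the half-line\<close>

text \<open>The complement of the support is a union of null open sets, and a countable basis
  reduces it to countably many null basic sets. Traces on \<open>space M\<close> appear because laws
  on the half-line carry the trace sigma-algebra.\<close>

lemma AE_in_supp:
  fixes M :: "'a::second_countable_topology measure"
  assumes "\<And>U. open U \<Longrightarrow> U \<inter> space M \<in> sets M"
  shows "AE x in M. x \<in> supp M"
proof -
  obtain B :: "'a set set" where B: "countable B" "topological_basis B"
    using ex_countable_basis by blast
  let ?N = "{U\<in>B. emeasure M (U \<inter> space M) = 0}"
  have "AE x in M. \<forall>U\<in>?N. x \<notin> U"
  proof (subst AE_ball_countable)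
    show "countable ?N" using B(1) by auto
    show "\<forall>U\<in>?N. AE x in M. x \<notin> U"
    proof
      fix U assume U: "U \<in> ?N"
      then have "open U" using B(2) topological_basis_open by blast
      with U assms show "AE x in M. x \<notin> U"
        by (intro AE_I[of _ _ "U \<inter> space M"]) auto
    qed
  qed
  then show ?thesis
  proof (rule AE_mp, intro AE_I2 impI)
    fix x assume x: "x \<in> space M" "\<forall>U\<in>?N. x \<notin> U"
    have "emeasure M (U \<inter> space M) > 0" if U: "open U" "x \<in> U" for U
    proof -
      obtain V where V: "V \<in> B" "x \<in> V" "V \<subseteq> U"
        using topological_basisE[OF B(2) U] by blast
      then have "emeasure M (V \<inter> space M) \<noteq> 0" using x by blast
      moreover have "emeasure M (V \<inter> space M) \<le> emeasure M (U \<inter> space M)"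
        using V assms[OF U(1)] by (intro emeasure_mono) auto
      ultimately show ?thesis by (auto simp: zero_less_iff_neq_zero)
    qed
    with x show "x \<in> supp M" by (auto simp: supp_def)
  qed
qed

lemma supp_image_distr:
  assumes f: "continuous_on UNIV f" and M: "sets M = sets borel" and x: "x \<in> supp M"
  shows "f x \<in> supp (distr M borel f)"
proof -
  have mf: "f \<in> borel_measurable M"
    using borel_measurable_continuous_onI[OF f] M by (simp cong: measurable_cong_sets)
  have sp: "space M = UNIV" using sets_eq_imp_space_eq[OF M] by simp
  show ?thesis unfolding supp_def
  proof (safe)
    fix U assume U: "open U" "f x \<in> U"
    have "open (f -` U)" using f U open_vimage by blast
    then show "emeasure (distr M borel f) (U \<inter> space (distr M borel f)) > 0"
      using x U mf sp by (auto simp: supp_def emeasure_distr)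
  qed simp
qed

lemma law_on_halflineD:
  assumes "law_on_halfline F"
  shows "prob_space F" "sets F = sets halfline" "space F = {0..}"
proof -
  show "prob_space F" "sets F = sets halfline"
    using assms by (auto simp: law_on_halfline_def space_prob_algebra)
  then show "space F = {0..}"
    using sets_eq_imp_space_eq[of F halfline] by (simp add: space_restrict_space)
qed

text \<open>Links two ways of saying that a law lives on \<open>[0, sbar]\<close>: fibers use the
  support, the injectivity clause uses the mass.\<close>

lemma law_mass_of_supp:
  assumes F: "law_on_halfline F" and "supp F \<subseteq> {0..sbar}"
  shows "emeasure F {0..sbar} = 1"
proof -
  note law_on_halflineD[OF F]
  interpret prob_space F by fact
  have sets: "A \<inter> {0..} \<in> sets F" if "A \<in> sets borel" for A
    using that \<open>sets F = _\<close> by (auto simp: sets_restrict_space)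
  have "AE x in F. x \<in> supp F"
    by (rule AE_in_supp) (simp add: \<open>space F = _\<close> sets)
  then have "AE x in F. x \<in> {0..sbar}" using assms(2) by (auto elim!: eventually_mono)
  moreover have "{0..sbar} \<in> sets F" using sets[of "{0..sbar}"] by (simp add: Int_absorb2)
  ultimately show ?thesis by (simp add: emeasure_eq_1_AE)
qed

section \<open>Uniqueness of the exponent and the coefficient at 0\<close>

text \<open>Two densities of the same law agree at points arbitrarily close to 0. Along these points
  the two power functions are asymptotically equal, which forces first equal exponents and then
  equal coefficients.\<close>

lemma ax_A1_unique:
  assumes C: "admissible_consts C"
    and 1: "ax_A1 C F \<alpha> L" and 2: "ax_A1 C F \<alpha>' L'"
  shows "\<alpha> = \<alpha>' \<and> L = L'"
proof -
  obtain s0 f where f: "c_s0bar C \<le> s0" "f \<in> borel_measurable borel" "\<forall>s\<in>{0<..<s0}. 0 \<le> f s"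
       "\<And>B. B\<in>sets borel \<Longrightarrow> B \<subseteq> {0<..<s0} \<Longrightarrow> emeasure F B = (\<integral>\<^sup>+s\<in>B. ennreal (f s) \<partial>lborel)"
       "f \<sim>[at_right 0] (\<lambda>s. L * s powr \<alpha>)" and L: "L > 0"
    using 1 unfolding ax_A1_def by blast
  obtain s0' f' where f': "c_s0bar C \<le> s0'" "f' \<in> borel_measurable borel" "\<forall>s\<in>{0<..<s0'}. 0 \<le> f' s"
       "\<And>B. B\<in>sets borel \<Longrightarrow> B \<subseteq> {0<..<s0'} \<Longrightarrow> emeasure F B = (\<integral>\<^sup>+s\<in>B. ennreal (f' s) \<partial>lborel)"
       "f' \<sim>[at_right 0] (\<lambda>s. L' * s powr \<alpha>')" and L': "L' > 0"
    using 2 unfolding ax_A1_def by blast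
  \<comment> \<open>The two instances of the axiom may come with different \<open>s0\<close>; the
    class constant bounds both from below and gives a common interval.\<close>
  define d where "d = c_s0bar C"
  have d: "d > 0" "d \<le> s0" "d \<le> s0'"
    using C f(1) f'(1) by (auto simp: d_def admissible_consts_def)
  note [measurable] = f(2) f'(2)
  \<comment> \<open>Cut off to \<open>(0, d)\<close>, both functions are densities of the same
    measure, the restriction of \<open>F\<close>.\<close>
  have "AE s in lborel. ennreal (f s) * indicator {0<..<d} s = ennreal (f' s) * indicator {0<..<d} s"
  proof (rule sigma_finite_measure.density_unique[OF sigma_finite_lborel])
    show "density lborel (\<lambda>s. ennreal (f s) * indicator {0<..<d} s) =
          density lborel (\<lambda>s. ennreal (f' s) * indicator {0<..<d} s)"
    proof (rule measure_eqI)
      fix A assume "A \<in> sets (density lborel (\<lambda>s. ennreal (f s) * indicator {0<..<d} s))"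
      then have A[measurable]: "A \<in> sets borel" by simp
      have "emeasure F (A \<inter> {0<..<d}) = (\<integral>\<^sup>+s\<in>A \<inter> {0<..<d}. ennreal (f s) \<partial>lborel)"
        using d by (intro f(4)) auto
      moreover have "emeasure F (A \<inter> {0<..<d}) = (\<integral>\<^sup>+s\<in>A \<inter> {0<..<d}. ennreal (f' s) \<partial>lborel)"
        using d by (intro f'(4)) auto
      ultimately show "emeasure (density lborel (\<lambda>s. ennreal (f s) * indicator {0<..<d} s)) A =
                 emeasure (density lborel (\<lambda>s. ennreal (f' s) * indicator {0<..<d} s)) A"
        by (simp add: emeasure_density indicator_inter_arith mult_ac)
    qed simp
  qed measurable
  then have ae: "AE s in lborel. s \<in> {0<..<d} \<longrightarrow> f s = f' s"
  proof (rule AE_mp, intro AE_I2 impI)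
    fix s :: real
    assume "ennreal (f s) * indicator {0<..<d} s = ennreal (f' s) * indicator {0<..<d} s" "s \<in> {0<..<d}"
    with f(3) f'(3) d show "f s = f' s" by (auto simp: ennreal_inj)
  qed
  \<comment> \<open>If the densities differed on a whole right neighbourhood of 0, an interval of
    positive length would be Lebesgue null.\<close>
  have freq: "\<not> eventually (\<lambda>s. f s \<noteq> f' s) (at_right 0)"
  proof
    assume "eventually (\<lambda>s. f s \<noteq> f' s) (at_right 0)"
    then obtain b where b: "b > 0" "\<And>y. 0 < y \<Longrightarrow> y < b \<Longrightarrow> f y \<noteq> f' y"
      unfolding eventually_at_right_field by auto
    have "AE s in lborel. s \<notin> {0<..<min b d}"
      using ae b(2) by (auto elim!: eventually_mono)
    then have "{0<..<min b d} \<in> null_sets lborel"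
      by (simp add: AE_iff_null_sets)
    with b d show False by (simp add: null_sets_def)
  qed
  \<comment> \<open>The two densities agree only almost everywhere, so their asymptotics are compared along
    the points near 0 at which they do agree.\<close>
  define G where "G = inf (at_right 0) (principal {s. f s = f' s})"
  have G: "G \<le> at_right 0" "eventually (\<lambda>s. f s = f' s) G" "G \<noteq> bot"
    using freq by (auto simp: G_def eventually_inf_principal trivial_limit_def)
  have "(\<lambda>s. L * s powr \<alpha>) \<sim>[G] (\<lambda>s. L' * s powr \<alpha>')"
  proof -
    have "f \<sim>[G] (\<lambda>s. L * s powr \<alpha>)" "f' \<sim>[G] (\<lambda>s. L' * s powr \<alpha>')"
      by (rule asymp_equivI[OF tendsto_mono[OF G(1) asymp_equivD]], fact)+
    moreover have "f \<sim>[G] f'" by (rule asymp_equiv_refl_ev[OF G(2)])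
    ultimately show ?thesis 
      using asymp_equiv_trans[OF asymp_equiv_trans[OF asymp_equiv_symI]] by blast
  qed
  \<comment> \<open>Asymptotic equivalence counts the quotient 0/0 as 1; both functions are nonzero
    to the right of 0, so the plain quotient converges.\<close>
  then have "((\<lambda>s. (L * s powr \<alpha>) / (L' * s powr \<alpha>')) \<longlongrightarrow> 1) G"
    by (rule asymp_equivD_strong)
      (use L L' in \<open>auto simp: eventually_at_filter intro!: filter_leD[OF G(1)]\<close>)
  moreover have "eventually (\<lambda>s::real. s > 0) G"
    by (rule filter_leD[OF G(1)]) (simp add: eventually_at_right_less)
  then have "eventually (\<lambda>s. (L * s powr \<alpha>) / (L' * s powr \<alpha>') = L / L' * s powr (\<alpha> - \<alpha>')) G"
    by eventually_elim (simp add: powr_diff)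
  ultimately have lim: "((\<lambda>s. L / L' * s powr (\<alpha> - \<alpha>')) \<longlongrightarrow> 1) G"
    by (rule Lim_transform_eventually)
  have id0: "((\<lambda>s::real. s) \<longlongrightarrow> 0) G" "eventually (\<lambda>s::real. s > 0) G"
    by (rule tendsto_mono[OF G(1) tendsto_ident_at], fact)
  \<comment> \<open>A positive exponent forces the limit 0 instead of 1. The opposite order of the
    exponents is reduced to this case by taking reciprocals.\<close>
  have *: False if "a > 0" "c > 0" "((\<lambda>s. c * s powr a) \<longlongrightarrow> 1) G" for a c :: real
  proof -
    have "((\<lambda>s. s powr a) \<longlongrightarrow> 0 powr a) G"
      using that id0 by (intro tendsto_powr2) (auto elim!: eventually_mono)
    then have "((\<lambda>s. c * s powr a) \<longlongrightarrow> c * 0) G"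
      by (intro tendsto_intros) simp
    from tendsto_unique[OF G(3) this that(3)] show False by simp
  qed
  have "\<not> \<alpha> > \<alpha>'" using *[of "\<alpha> - \<alpha>'" "L / L'"] lim L L' by auto
  moreover have "\<not> \<alpha> < \<alpha>'"
  proof
    assume "\<alpha> < \<alpha>'"
    have "((\<lambda>s. inverse (L / L' * s powr (\<alpha> - \<alpha>'))) \<longlongrightarrow> inverse 1) G"
      using lim by (intro tendsto_inverse) auto
    then have "((\<lambda>s. L' / L * s powr (\<alpha>' - \<alpha>)) \<longlongrightarrow> 1) G"
      using powr_minus[of _ "\<alpha> - \<alpha>'"] by (simp add: field_simps)
    with *[of "\<alpha>' - \<alpha>" "L' / L"] \<open>\<alpha> < \<alpha>'\<close> L L' show False by auto
  qed
  ultimately have eq: "\<alpha> = \<alpha>'" by simp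
  have "((\<lambda>s. L / L') \<longlongrightarrow> 1) G"
    by (rule Lim_transform_eventually[OF lim]) (rule eventually_mono[OF id0(2)], simp add: eq)
  then have "L / L' = 1" using G(3) by (simp add: tendsto_const_iff)
  with L' eq show ?thesis by simp
qed


section \<open>Moments of bounded laws and cancellation in convolutions\<close>

lemma integrable_power_bounded:
  assumes "real_distribution M" and b: "AE x in M. \<bar>x\<bar> \<le> R"
  shows "integrable M (\<lambda>x::real. x ^ n)"
proof -
  interpret real_distribution M by fact
  show ?thesis
    using b by (intro integrable_const_bound[where B="R ^ n"])
      (auto elim!: eventually_mono simp: power_abs power_mono)
qed

text \<open>The moments are the Taylor coefficients of the characteristic function. For a law
  bounded by \<open>R\<close> the remainder of order \<open>n\<close> is at most
  \<open>2 * (\<bar>t\<bar> * R) ^ n / fact n\<close>, a multiple of a term of the exponential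
  series, so the expansion converges at every \<open>t\<close> and Levy's uniqueness theorem
  applies.\<close>

lemma bounded_moments_determine:
  assumes M: "real_distribution M" and N: "real_distribution N"
    and bM: "AE x in M. \<bar>x\<bar> \<le> R" and bN: "AE x in N. \<bar>x\<bar> \<le> R"
    and eq: "\<And>n. (\<integral>x. x ^ n \<partial>M) = (\<integral>x. x ^ n \<partial>N)"
  shows "M = N"
proof (rule Levy_uniqueness[OF M N], rule ext)
  fix t :: real
  have *: "(\<lambda>n. \<Sum>k\<le>n. ((\<i> * t)^k / fact k) * (\<integral>x. x^k \<partial>M)) \<longlonglongrightarrow> char M t"
    if M: "real_distribution M" and b: "AE x in M. \<bar>x\<bar> \<le> R" for M
  proof -
    interpret real_distribution M by fact
    have bound: "norm ((\<Sum>k\<le>n. ((\<i> * t)^k / fact k) * (\<integral>x. x^k \<partial>M)) - char M t) \<le> 2 * (inverse (fact n) * (\<bar>t\<bar> * R) ^ n)" for n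
    proof -
      have "(\<integral>x. \<bar>x\<bar>^n \<partial>M) \<le> (\<integral>x. R ^ n \<partial>M)"
        using b integrable_power_bounded[OF M b, of n, THEN integrable_abs]
        by (intro integral_mono_AE) (auto elim!: eventually_mono simp: power_abs power_mono)
      then have E: "(\<integral>x. \<bar>x\<bar>^n \<partial>M) \<le> R ^ n" using prob_space by simp
      have "norm ((\<Sum>k\<le>n. ((\<i> * t)^k / fact k) * (\<integral>x. x^k \<partial>M)) - char M t)
          \<le> (2*\<bar>t\<bar>^n / fact n) * (\<integral>x. \<bar>x\<bar>^n \<partial>M)"
        using char_approx1[of n t] integrable_power_bounded[OF M b] by (simp add: norm_minus_commute)
      also have "\<dots> \<le> (2*\<bar>t\<bar>^n / fact n) * R ^ n"
        using E by (intro mult_left_mono) auto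
      finally show ?thesis by (simp add: power_mult_distrib field_simps)
    qed
    have "(\<lambda>n. 2 * (inverse (fact n) * (\<bar>t\<bar> * R) ^ n)) \<longlonglongrightarrow> 0"
      using summable_LIMSEQ_zero[OF summable_exp[of "\<bar>t\<bar> * R"]] tendsto_mult_right_zero by blast
    then have "(\<lambda>n. (\<Sum>k\<le>n. ((\<i> * t)^k / fact k) * (\<integral>x. x^k \<partial>M)) - char M t) \<longlonglongrightarrow> 0"
      by (rule Lim_null_comparison[OF always_eventually[OF allI[OF bound]]])
    then show ?thesis by (rule Lim_null[THEN iffD2])
  qed
  show "char M t = char N t"
    using *[OF M bM] *[OF N bN] unfolding eq by (rule LIMSEQ_unique)
qed

text \<open>Expand \<open>(x + y) ^ n\<close> under the product measure. The bound \<open>R\<close>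
  makes every monomial integrable, so the sum can be integrated term by term and Fubini splits each
  mixed moment.\<close>

lemma convolution_moment:
  assumes M: "real_distribution M" and N: "real_distribution N"
    and bM: "AE x in M. \<bar>x\<bar> \<le> R" and bN: "AE x in N. \<bar>x\<bar> \<le> R"
  shows "(\<integral>z. z ^ n \<partial>(M \<star> N)) =
    (\<Sum>k\<le>n. of_nat (n choose k) * ((\<integral>x. x ^ k \<partial>M) * (\<integral>y. y ^ (n - k) \<partial>N)))"
proof -
  interpret M: real_distribution M by fact
  interpret N: real_distribution N by fact
  interpret P: pair_prob_space M N ..
  have ae: "AE p in M \<Otimes>\<^sub>M N. \<bar>fst p\<bar> \<le> R \<and> \<bar>snd p\<bar> \<le> R"
  proof (rule P.AE_pair_measure)
    show "AE x in M. AE y in N. \<bar>fst (x, y)\<bar> \<le> R \<and> \<bar>snd (x, y)\<bar> \<le> R"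
      using bM by (rule AE_mp) (use bN in \<open>auto elim!: eventually_mono\<close>)
  qed measurable
  have int: "integrable (M \<Otimes>\<^sub>M N) (\<lambda>p. fst p ^ i * snd p ^ j)" for i j
  proof (rule P.P.integrable_const_bound[where B="R ^ i * R ^ j"])
    show "AE p in M \<Otimes>\<^sub>M N. norm (fst p ^ i * snd p ^ j) \<le> R ^ i * R ^ j"
      using ae by (rule AE_mp) (auto intro!: AE_I2 mult_mono power_mono simp: abs_mult power_abs)
  qed measurable
  have prod: "(\<integral>p. fst p ^ i * snd p ^ j \<partial>(M \<Otimes>\<^sub>M N)) = (\<integral>x. x ^ i \<partial>M) * (\<integral>y. y ^ j \<partial>N)" for i j
    using P.integral_fst'[OF int[of i j]] by simp
  have "(\<integral>z. z ^ n \<partial>(M \<star> N)) = (\<integral>p. (fst p + snd p) ^ n \<partial>(M \<Otimes>\<^sub>M N))"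
    unfolding convolution_def by (subst integral_distr) (auto simp: case_prod_beta')
  also have "\<dots> = (\<integral>p. (\<Sum>k\<le>n. of_nat (n choose k) * (fst p ^ k * snd p ^ (n - k))) \<partial>(M \<Otimes>\<^sub>M N))"
    by (simp add: binomial_ring mult.assoc)
  also have "\<dots> = (\<Sum>k\<le>n. of_nat (n choose k) * ((\<integral>x. x ^ k \<partial>M) * (\<integral>y. y ^ (n - k) \<partial>N)))"
    by (subst Bochner_Integration.integral_sum) (auto simp: int prod)
  finally show ?thesis .
qed

text \<open>In the formula for the \<open>n\<close>-th moment, the term \<open>k = n\<close> is the
  \<open>n\<close>-th moment of \<open>M\<close> times the total mass 1 of \<open>N\<close>; all
  other terms contain only lower moments of \<open>M\<close>, known to agree by induction. The
  unknown moment thus has coefficient 1 whatever the law \<open>N\<close>.\<close>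

lemma convolution_cancel_bounded:
  assumes M: "real_distribution M" and M': "real_distribution M'" and N: "real_distribution N"
    and b: "AE x in M. \<bar>x\<bar> \<le> R" "AE x in M'. \<bar>x\<bar> \<le> R" "AE x in N. \<bar>x\<bar> \<le> R"
    and eq: "(M \<star> N) = (M' \<star> N)"
  shows "M = M'"
proof (rule bounded_moments_determine[OF M M' b(1,2)])
  interpret N: real_distribution N by fact
  fix n
  show "(\<integral>x. x ^ n \<partial>M) = (\<integral>x. x ^ n \<partial>M')"
  proof (induction n rule: less_induct)
    case (less n)
    have N0: "(\<integral>y. y ^ 0 \<partial>N) = 1" using N.prob_space by simp
    let ?t = "\<lambda>M k. of_nat (n choose k) * ((\<integral>x. x ^ k \<partial>M) * (\<integral>y. y ^ (n - k) \<partial>N))"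
    have "(\<Sum>k\<le>n. ?t M k) = (\<Sum>k\<le>n. ?t M' k)"
      using convolution_moment[OF M N b(1,3), of n] convolution_moment[OF M' N b(2,3), of n] eq by simp
    moreover have "(\<Sum>k<n. ?t M k) = (\<Sum>k<n. ?t M' k)"
      by (intro sum.cong) (auto simp: less)
    ultimately have "?t M n = ?t M' n"
      by (simp add: lessThan_Suc_atMost[symmetric])
    then show ?case using N0 by simp
  qed
qed

section \<open>Location families\<close>

text \<open>Shifting left by \<open>c\<close> is the continuous map \<open>x - ennreal c\<close>, so
  it carries each support point \<open>x\<close> to a support point that is at most
  \<open>x\<close>. The constant kernels serve only to apply \<open>lower_edge\<close> to a single
  law.\<close>

lemma lower_edge_translate_le:
  assumes "c \<ge> 0" "sets \<mu> = sets borel"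
  shows "lower_edge (\<lambda>_. distr \<mu> borel (\<lambda>w. ennreal (r - c + w))) s
    \<le> lower_edge (\<lambda>_. distr \<mu> borel (\<lambda>w. ennreal (r + w))) s"
    (is "lower_edge (\<lambda>_. ?A) s \<le> lower_edge (\<lambda>_. ?B) s")
proof -
  note [measurable_cong] = assms(2)
  have cont: "continuous_on UNIV (\<lambda>x. x - ennreal c)"
    by (auto simp: continuous_on_def intro!: tendsto_intros)
  \<comment> \<open>Truncation at 0 commutes with the shift: subtraction in \<open>ennreal\<close>
    is itself truncated, and \<open>c \<ge> 0\<close>.\<close>
  have A: "?A = distr ?B borel (\<lambda>x. x - ennreal c)"
    by (subst distr_distr) (auto simp: o_def ennreal_minus assms(1) algebra_simps)
  show ?thesis unfolding lower_edge_def
  proof (rule Inf_mono)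
    fix x assume x: "x \<in> supp ?B \<inter> {x. x < \<infinity>}"
    then have "x - ennreal c \<in> supp ?A"
      unfolding A by (intro supp_image_distr[OF cont]) auto
    moreover have "x - ennreal c \<le> x" by (simp add: diff_le_self_ennreal)
    ultimately show "\<exists>y\<in>supp ?A \<inter> {x. x < \<infinity>}. y \<le> x" using x le_less_trans by blast
  qed
qed

text \<open>If \<open>g s' \<le> g s\<close> for some \<open>s < s'\<close>, the law at
  \<open>s'\<close> is the law at \<open>s\<close> shifted left, so its lower edge cannot be
  larger.\<close>

lemma location_map_strict_mono:
  assumes "strict_mono_on {0..} (lower_edge K)" "sets \<mu> = sets borel"
    and K: "\<And>s. s \<ge> 0 \<Longrightarrow> K s = distr \<mu> borel (\<lambda>w. ennreal (g s + w))"
  shows "strict_mono_on {0..} (g :: real \<Rightarrow> real)"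
proof (rule strict_mono_onI, rule ccontr)
  fix s s' :: real assume s: "s \<in> {0..}" "s' \<in> {0..}" "s < s'" "\<not> g s < g s'"
  then have "lower_edge K s' \<le> lower_edge K s"
    using lower_edge_translate_le[of "g s - g s'" \<mu> "g s" s] assms(2) K
    by (simp add: lower_edge_def)
  with strict_mono_onD[OF assms(1) s(1-3)] show False by simp
qed

text \<open>Turns equal observed laws into equal convolutions of real laws. Since
  \<open>g s + W\<close> is almost surely nonnegative, \<open>enn2real\<close> undoes the passage to
  \<open>ennreal\<close>; mixing over \<open>s\<close> and changing variables along \<open>g\<close>
  then gives the convolution integral.\<close>

lemma observed_location_law:
  assumes F: "law_on_halfline F" and K: "markov_kernel K"
    and \<mu>: "\<mu> \<in> space (prob_algebra borel)" and g: "g \<in> borel_measurable halfline"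
    and nonneg: "\<And>s. s \<ge> 0 \<Longrightarrow> AE w in \<mu>. 0 \<le> g s + w"
    and loc: "\<And>s. s \<ge> 0 \<Longrightarrow> K s = distr \<mu> borel (\<lambda>w. ennreal (g s + w))"
  shows "(distr F borel g \<star> \<mu>) = distr (observed K F) borel enn2real"
proof -
  note F' = law_on_halflineD[OF F]
  interpret F: prob_space F by fact
  have \<mu>': "sets \<mu> = sets borel" "prob_space \<mu>" using \<mu> by (auto simp: space_prob_algebra)
  interpret \<mu>: prob_space \<mu> by fact
  note [measurable_cong] = \<mu>'(1)
  have sp: "space \<mu> = UNIV" using sets_eq_imp_space_eq[OF \<mu>'(1)] by simp
  have gF[measurable]: "g \<in> borel_measurable F"
    using g F'(2) by (simp cong: measurable_cong_sets)
  interpret G: prob_space "distr F borel g" by (rule F.prob_space_distr) simp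
  have FA: "F \<in> space (prob_algebra halfline)" using F by (simp add: law_on_halfline_def)
  have KA: "K \<in> halfline \<rightarrow>\<^sub>M prob_algebra borel" using K by (simp add: markov_kernel_def)
  have so: "sets (observed K F) = sets borel"
    unfolding observed_def
  proof (rule sets_bind)
    fix x assume "x \<in> space F"
    then show "sets (K x) = sets borel" using loc F'(3) by simp
  qed (simp add: F'(3))
  note [measurable_cong] = so
  show ?thesis
  proof (rule measure_eqI)
    fix A assume "A \<in> sets (distr F borel g \<star> \<mu>)"
    then have A[measurable]: "A \<in> sets borel" by simp
    have [measurable]: "enn2real -` A \<in> sets borel"
      using measurable_sets[OF borel_measurable_enn2real[OF measurable_ident] A] by simp
    have meas: "(\<lambda>x. emeasure \<mu> {w. w + x \<in> A}) \<in> borel_measurable borel"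
    proof (rule \<mu>.measurable_emeasure)
      have "Measurable.pred (borel \<Otimes>\<^sub>M \<mu>) (\<lambda>p. snd p + fst p \<in> A)" by measurable
      then show "{p \<in> space (borel \<Otimes>\<^sub>M \<mu>). snd p \<in> {w. w + fst p \<in> A}} \<in> sets (borel \<Otimes>\<^sub>M \<mu>)"
        by (simp add: pred_def)
    qed (simp add: sp)
    have "emeasure (distr (observed K F) borel enn2real) A = emeasure (observed K F) (enn2real -` A)"
      using sets_eq_imp_space_eq[OF so] by (subst emeasure_distr) auto
    also have "\<dots> = (\<integral>\<^sup>+s. emeasure (K s) (enn2real -` A) \<partial>F)"
      unfolding observed_def by (rule emeasure_bind_prob_algebra[OF FA KA]) simp
    also have "\<dots> = (\<integral>\<^sup>+s. emeasure \<mu> {w. w + g s \<in> A} \<partial>F)"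
    proof (rule nn_integral_cong)
      fix s assume "s \<in> space F"
      then have s: "s \<ge> 0" using F'(3) by simp
      have "emeasure (K s) (enn2real -` A) = emeasure \<mu> {w. enn2real (ennreal (g s + w)) \<in> A}"
        unfolding loc[OF s] by (subst emeasure_distr) (auto simp: sp vimage_def)
      also have "\<dots> = emeasure \<mu> {w. w + g s \<in> A}"
        using nonneg[OF s] by (intro emeasure_eq_AE) (auto elim!: eventually_mono simp: add.commute \<mu>'(1))
      finally show "emeasure (K s) (enn2real -` A) = emeasure \<mu> {w. w + g s \<in> A}" .
    qed
    also have "\<dots> = (\<integral>\<^sup>+x. emeasure \<mu> {w. w + x \<in> A} \<partial>distr F borel g)"
      by (rule nn_integral_distr[symmetric, OF gF]) (use meas in simp)
    also have "\<dots> = emeasure (distr F borel g \<star> \<mu>) A"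
      by (rule convolution_emeasure[symmetric])
        (auto simp: sp \<mu>'(1) G.finite_measure_axioms \<mu>.finite_measure_axioms)
    finally show "emeasure (distr F borel g \<star> \<mu>) A = emeasure (distr (observed K F) borel enn2real) A" ..
  qed simp
qed

text \<open>For \<open>s\<close> and \<open>t\<close> in the half-line, \<open>s \<le> t\<close> iff
  \<open>g s \<le> g t\<close>, so the distribution function of \<open>F\<close> at \<open>t\<close>
  is that of the image law at \<open>g t\<close>.\<close>

lemma law_eqI_strict_mono_image:
  assumes F: "law_on_halfline F" and F': "law_on_halfline F'" and g: "strict_mono_on {0..} (g :: real \<Rightarrow> real)"
    and gm: "g \<in> borel_measurable halfline"
    and eq: "distr F borel g = distr F' borel g"
  shows "F = F'"
proof -
  have [measurable]: "g \<in> borel_measurable F" "g \<in> borel_measurable F'"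
     "(\<lambda>x. x) \<in> F \<rightarrow>\<^sub>M borel" "(\<lambda>x. x) \<in> F' \<rightarrow>\<^sub>M borel"
    using gm law_on_halflineD(2)[OF F] law_on_halflineD(2)[OF F']
    by (auto simp: measurable_restrict_space1 cong: measurable_cong_sets)
  \<comment> \<open>For negative \<open>t\<close> the monotonicity of \<open>g\<close> says nothing,
    but \<open>F\<close> has no mass there.\<close>
  have cdf: "emeasure (distr F borel (\<lambda>x. x)) {..t} = (if t < 0 then 0 else emeasure (distr F borel g) {..g t})"
    if F: "law_on_halfline F" and [measurable]: "g \<in> borel_measurable F" "(\<lambda>x. x) \<in> F \<rightarrow>\<^sub>M borel" for F t
  proof (cases "t < 0")
    case True
    then have "{..t} \<inter> {0..} = {}" by auto
    then show ?thesis using True law_on_halflineD(3)[OF F] by (simp add: emeasure_distr)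
  next
    case False
    then show ?thesis using g law_on_halflineD(3)[OF F]
      by (auto simp: emeasure_distr strict_mono_on_less_eq intro!: arg_cong[of _ _ "emeasure F"])
  qed
  \<comment> \<open>The identity push-forward moves \<open>F\<close> from the half-line to the Borel
    sets of the whole line, where distribution functions determine laws; the equality is carried
    back below.\<close>
  have rd: "real_distribution (distr F borel (\<lambda>x. x))" "real_distribution (distr F' borel (\<lambda>x. x))"
    using F F' by (auto intro!: prob_space.real_distribution_distr law_on_halflineD(1))
  have "distr F borel (\<lambda>x. x) = distr F' borel (\<lambda>x. x)"
    by (intro cdf_unique rd) (auto simp: cdf_def fun_eq_iff measure_def cdf F F' eq)
  then have D: "emeasure (distr F borel (\<lambda>x. x)) A = emeasure (distr F' borel (\<lambda>x. x)) A" for A by simp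
  show ?thesis
  proof (rule measure_eqI)
    show "sets F = sets F'" using law_on_halflineD(2) F F' by simp
    fix A assume "A \<in> sets F"
    then have A: "A \<in> sets borel" "A \<subseteq> {0..}"
      using law_on_halflineD(2)[OF F] by (auto simp: sets_restrict_space)
    with D[of A] show "emeasure F A = emeasure F' A"
      using law_on_halflineD(3)[OF F] law_on_halflineD(3)[OF F']
      by (simp add: emeasure_distr Int_absorb2)
  qed
qed

lemma location_family_injective:
  assumes cand: "candidate_family \<Theta> K" and loc: "location_family \<Theta> K"
  shows "injectivity_clause \<Theta> K sbar"
  unfolding injectivity_clause_def
proof (intro ballI inj_onI, safe)
  fix \<theta> F F' assume \<theta>: "\<theta> \<in> \<Theta>" and eq: "observed (K \<theta>) F = observed (K \<theta>) F'"
    and F: "law_on_halfline F" "emeasure F {0..sbar} = 1"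
    and F': "law_on_halfline F'" "emeasure F' {0..sbar} = 1"
  obtain g \<mu> where \<mu>: "\<mu> \<in> space (prob_algebra (borel :: real measure))" "compact (supp \<mu>)"
    and g: "g \<in> borel_measurable halfline" "\<And>s. s \<ge> 0 \<Longrightarrow> AE w in \<mu>. 0 \<le> g s + w"
      "\<And>s. s \<ge> 0 \<Longrightarrow> K \<theta> s = distr \<mu> borel (\<lambda>w. ennreal (g s + w))"
    using loc \<theta> unfolding location_family_def by blast
  have \<mu>': "sets \<mu> = sets borel" "prob_space \<mu>" using \<mu> by (auto simp: space_prob_algebra)
  have cand': "markov_kernel (K \<theta>)" "strict_mono_on {0..} (lower_edge (K \<theta>))"
    using cand \<theta> by (auto simp: candidate_family_def)
  \<comment> \<open>The strict increase of the edge map enters here; it yields both the bound on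
    \<open>g\<close> over \<open>[0, sbar]\<close> and the recovery of the law of \<open>S\<close>
    from that of \<open>g(S)\<close>.\<close>
  have mono: "strict_mono_on {0..} g"
    using location_map_strict_mono[OF cand'(2) \<mu>'(1)] g(3) by blast
  have "AE w in \<mu>. w \<in> supp \<mu>"
    using \<mu>'(1) sets_eq_imp_space_eq[OF \<mu>'(1)] by (intro AE_in_supp) auto
  moreover obtain R0 where "\<And>w. w \<in> supp \<mu> \<Longrightarrow> \<bar>w\<bar> \<le> R0"
    using compact_imp_bounded[OF \<mu>(2)] by (auto simp: bounded_iff)
  ultimately have bW: "AE w in \<mu>. \<bar>w\<bar> \<le> R0" by (auto elim!: eventually_mono)
  \<comment> \<open>One bound for the noise and for \<open>g\<close> on \<open>[0, sbar]\<close>,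
    where the monotone \<open>g\<close> takes its extreme values at the endpoints.\<close>
  define R where "R = max R0 (max \<bar>g 0\<bar> \<bar>g sbar\<bar>)"
  have gm: "g \<in> borel_measurable F" if "law_on_halfline F" for F
    using g(1) law_on_halflineD(2)[OF that] by (simp cong: measurable_cong_sets)
  have b: "AE x in distr F borel g. \<bar>x\<bar> \<le> R"
    if F: "law_on_halfline F" "emeasure F {0..sbar} = 1" for F
  proof -
    interpret prob_space F using law_on_halflineD(1)[OF F(1)] .
    \<comment> \<open>A nonmeasurable set has \<open>emeasure\<close> 0 by default, so mass 1 also
      shows that \<open>{0..sbar}\<close> is measurable.\<close>
    have "AE s in F. s \<in> {0..sbar}"
      using F(2) emeasure_notin_sets[of "{0..sbar}" F]
      by (intro AE_in_set_eq_1[THEN iffD2]) (auto simp: measure_def)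
    then have "AE s in F. \<bar>g s\<bar> \<le> R"
    proof (rule AE_mp, intro AE_I2 impI)
      fix s assume "s \<in> {0..sbar}"
      then have "g 0 \<le> g s" "g s \<le> g sbar"
        using mono by (auto simp: strict_mono_on_less_eq)
      then show "\<bar>g s\<bar> \<le> R" by (auto simp: R_def)
    qed
    then show ?thesis by (subst AE_distr_iff[OF gm[OF F(1)]]) auto
  qed
  have rd: "real_distribution (distr F borel g)" if "law_on_halfline F" for F
    using that by (intro prob_space.real_distribution_distr law_on_halflineD(1) gm)
  have "distr F borel g = distr F' borel g"
  proof (rule convolution_cancel_bounded[OF rd[OF F(1)] rd[OF F'(1)] _ b[OF F] b[OF F']])
    show "real_distribution \<mu>"
      using \<mu>' by (simp add: real_distribution_def real_distribution_axioms_def)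
    show "AE x in \<mu>. \<bar>x\<bar> \<le> R" using bW by (auto elim!: eventually_mono simp: R_def)
    show "(distr F borel g \<star> \<mu>) = (distr F' borel g \<star> \<mu>)"
      using observed_location_law[OF F(1) cand'(1) \<mu>(1) g]
        observed_location_law[OF F'(1) cand'(1) \<mu>(1) g] eq by simp
  qed
  then show "F = F'" by (rule law_eqI_strict_mono_image[OF F(1) F'(1) mono g(1)])
qed

section \<open>Fibers and identifiability\<close>

text \<open>Both kernels have the edge \<open>l0\<close>, so clause (C-a) gives them the same
  parameter. The two observed laws then come from one kernel of the family, and its injectivity
  separates the latent laws.\<close>

lemma fiber_law_unique:
  assumes cand: "candidate_family \<Theta> K" and inj: "injectivity_clause \<Theta> K sbar"
    and FK: "(F, K1) \<in> fiber C \<Theta> K sbar l0" "(F', K1') \<in> fiber C \<Theta> K sbar l0"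
    and eq: "observed K1 F = observed K1' F'"
  shows "F = F'"
proof -
  have F: "law_on_halfline F" "law_on_halfline F'"
    using FK by (auto simp: fiber_def M_reg_def obs_pair_def)
  obtain \<theta> where \<theta>: "\<theta> \<in> \<Theta>" "\<And>s. s \<ge> 0 \<Longrightarrow> K1 s = K \<theta> s" "\<And>s. s \<ge> 0 \<Longrightarrow> lower_edge K1 s = l0 s"
    using FK(1) by (auto simp: fiber_def)
  obtain \<theta>' where \<theta>': "\<theta>' \<in> \<Theta>" "\<And>s. s \<ge> 0 \<Longrightarrow> K1' s = K \<theta>' s" "\<And>s. s \<ge> 0 \<Longrightarrow> lower_edge K1' s = l0 s"
    using FK(2) by (auto simp: fiber_def)
  have "lower_edge (K \<theta>) s = lower_edge (K \<theta>') s" if "s \<ge> 0" for s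
    using \<theta>(2,3)[OF that] \<theta>'(2,3)[OF that] by (simp add: lower_edge_def)
  then have "\<theta> = \<theta>'" using cand \<theta>(1) \<theta>'(1) by (auto simp: candidate_family_def)
  \<comment> \<open>The kernels agree only for \<open>s \<ge> 0\<close>, which is exactly the space
    of \<open>F\<close> and \<open>F'\<close>.\<close>
  have "observed K1 F = observed (K \<theta>) F" "observed K1' F' = observed (K \<theta>) F'"
    unfolding observed_def \<open>\<theta> = \<theta>'\<close>
    using F \<theta>(2) \<theta>'(2) \<open>\<theta> = \<theta>'\<close> by (auto intro!: bind_cong simp: law_on_halflineD(3))
  with eq have "observed (K \<theta>) F = observed (K \<theta>) F'" by simp
  moreover have "emeasure F {0..sbar} = 1" "emeasure F' {0..sbar} = 1"
    using FK F by (auto intro!: law_mass_of_supp simp: fiber_def)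
  ultimately show ?thesis
    using inj \<theta>(1) F unfolding injectivity_clause_def inj_on_def by blast
qed

theorem mainTheorem6:
  fixes C :: class_consts
    and \<Theta> :: "(real^'k) set"
    and K :: "real^'k \<Rightarrow> real \<Rightarrow> ennreal measure"
    and sbar :: real
  assumes "admissible_consts C"
    and "candidate_family \<Theta> K"
  shows "(injectivity_clause \<Theta> K sbar \<longrightarrow>
      (\<forall>l0. admissible_edge \<Theta> K l0 \<longrightarrow>
        (\<forall>(F, K1)\<in>fiber C \<Theta> K sbar l0. \<forall>(F', K1')\<in>fiber C \<Theta> K sbar l0.
           observed K1 F = observed K1' F' \<longrightarrow>
             F = F' \<and>
             (\<forall>\<alpha> L \<alpha>' L'. ax_A1 C F \<alpha> L \<longrightarrow> ax_A1 C F' \<alpha>' L' \<longrightarrow>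
                (\<alpha>, L, p_tau C F) = (\<alpha>', L', p_tau C F'))) \<and>
        identifiable (\<lambda>(F, K1). (edge_coeff C F, p_tau C F)) (fiber C \<Theta> K sbar l0)))
    \<and> (location_family \<Theta> K \<longrightarrow> injectivity_clause \<Theta> K sbar)"
  proof (intro conjI impI allI)
  fix l0
  assume inj: "injectivity_clause \<Theta> K sbar" and "admissible_edge \<Theta> K l0"
  note unique = fiber_law_unique[OF assms(2) inj]
  show "\<forall>(F, K1)\<in>fiber C \<Theta> K sbar l0. \<forall>(F', K1')\<in>fiber C \<Theta> K sbar l0.
           observed K1 F = observed K1' F' \<longrightarrow>
             F = F' \<and>
             (\<forall>\<alpha> L \<alpha>' L'. ax_A1 C F \<alpha> L \<longrightarrow> ax_A1 C F' \<alpha>' L' \<longrightarrow>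
                (\<alpha>, L, p_tau C F) = (\<alpha>', L', p_tau C F'))"
    \<comment> \<open>Once \<open>F = F'\<close>, both parameter pairs satisfy the axiom for the
      same law and therefore coincide.\<close>
    using unique ax_A1_unique[OF assms(1)] by fast
  \<comment> \<open>Both coordinates are functions of the law alone, so equality of the laws gives
    equality of the values.\<close>
  show "identifiable (\<lambda>(F, K1). (edge_coeff C F, p_tau C F)) (fiber C \<Theta> K sbar l0)"
    unfolding identifiable_def using unique by fast
next
  assume "location_family \<Theta> K"
  then show "injectivity_clause \<Theta> K sbar" by (rule location_family_injective[OF assms(2)])
qed

end
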